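(* Let $(X,G)$ be a locally compact group action and let $\mu\in\mathcal{M}(X)$ be a Borel probability measure on $X$ (not assumed $G$-invariant). Then the following are equivalent: (1) $\mu$ has discrete spectrum; (2) $\mu$ has bounded measure-max-mean-complexity; (3) $\mu$ has bounded max-mean-complexity.
   Context: A locally compact group action is a pair $(X,G)$ where $X$ is a compact metric space with metric $d$ and $G$ is a locally compact group acting continuously on $X$. $\mathcal{M}(X)$ and $\mathcal{M}(G)$ denote the sets of all Borel probability measures on $X$ and on $G$ respectively. For $f\in C(X)$ and $g\in G$ put $(gf)(x)=f(gx)$ for $x\in X$. A measure $\mu\in\mathcal{M}(X)$ has discrete spectrum if for every $f\in C(X)$ the set $\{gf: g\in G\}$ is precompact in $L^2(\mu)$. For $\rho\in\mathcal{M}(G)$ and $x,y\in X$ put $d_\rho(x,y)=\int_G d(gx,gy)\,d\rho(g)$, and for $\epsilon>0$ put $B_\rho(x,\epsilon)=\{y\in X: d_\rho(x,y)<\epsilon\}$. Let $S_\rho(X,\mu,G,\epsilon)$ be the minimal natural number $K$ such that there exists a subset $\{x_1,\dots,x_K\}\subseteq X$ with $\mu\big(\bigcup_{k=1}^K B_\rho(x_k,\epsilon)\big)>1-\epsilon$. $F(G)$ is the collection of all finite (nonempty) subsets of $G$, and for $E\in F(G)$, $\rho_E=\frac{1}{|E|}\sum_{g\in E}\delta_g$, where $\delta_g$ is the Dirac measure at $g$. $\mu$ has bounded measure-max-mean-complexity if for every $\epsilon>0$ there is $K(\epsilon)>0$ such that $S_\rho(X,\mu,G,\epsilon)<K(\epsilon)$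 for every $\rho\in\mathcal{M}(G)$. $\mu$ has bounded max-mean-complexity if for every $\epsilon>0$ there is $K(\epsilon)>0$ such that $S_{\rho_E}(X,\mu,G,\epsilon)<K(\epsilon)$ for every $E\in F(G)$. *)

theory Defs
  imports "HOL-Probability.Probability"
begin

section \<open>Locally compact group actions\<close>

text \<open>
  The group is written additively, because \<^class>\<open>topological_group_add\<close> is the type class of
  (not necessarily commutative) topological groups; the identity is \<open>0\<close>. As usual,
  locally compact groups are Hausdorff. Joint continuity of the action is required.
\<close>

locale locally_compact_group_action =
  fixes act :: "'g::{topological_group_add, t2_space} \<Rightarrow> 'x::metric_space \<Rightarrow> 'x"
  assumes compact_space: "compact (UNIV :: 'x set)"
    and locally_compact_group: "locally_compact_space (euclidean :: 'g topology)"
    and act_zero: "act 0 x = x"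
    and act_add: "act (g + h) x = act g (act h x)"
    and continuous_act: "continuous_on UNIV (\<lambda>(g, x). act g x)"

definition borel_prob_measures :: "'a::topological_space measure set" where
  "borel_prob_measures = {M. prob_space M \<and> sets M = sets borel}"

section \<open>The metric space \<open>L\<^sup>2\<close>\<close>

text \<open>Points of \<open>L\<^sup>2(M)\<close> are classes of square integrable functions modulo equality almost
  everywhere.\<close>

definition L2_fun :: "'a measure \<Rightarrow> ('a \<Rightarrow> complex) set" where
  "L2_fun M = {f \<in> borel_measurable M. integrable M (\<lambda>x. (cmod (f x))\<^sup>2)}"

definition L2_class :: "'a measure \<Rightarrow> ('a \<Rightarrow> complex) \<Rightarrow> ('a \<Rightarrow> complex) set" where
  "L2_class M f = {h \<in> L2_fun M. AE x in M. h x = f x}"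

definition L2 :: "'a measure \<Rightarrow> ('a \<Rightarrow> complex) set set" where
  "L2 M = L2_class M ` L2_fun M"

text \<open>Independence of the chosen representatives is lemma \<open>L2_dist_class\<close> below.\<close>

definition L2_dist :: "'a measure \<Rightarrow> ('a \<Rightarrow> complex) set \<Rightarrow> ('a \<Rightarrow> complex) set \<Rightarrow> real" where
  "L2_dist M A B =
     sqrt (\<integral>x. (cmod ((SOME f. f \<in> A) x - (SOME h. h \<in> B) x))\<^sup>2 \<partial>M)"

lemma L2_class_self: "f \<in> L2_fun M \<Longrightarrow> f \<in> L2_class M f"
  by (simp add: L2_class_def)

lemma L2_dist_class:
  assumes "f \<in> L2_fun M" "h \<in> L2_fun M"
  shows "L2_dist M (L2_class M f) (L2_class M h) = sqrt (\<integral>x. (cmod (f x - h x))\<^sup>2 \<partial>M)"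
proof -
  define f' where "f' = (SOME k. k \<in> L2_class M f)"
  define h' where "h' = (SOME k. k \<in> L2_class M h)"
  have f': "f' \<in> L2_class M f"
    unfolding f'_def using L2_class_self[OF assms(1)] by (rule someI[where P = "\<lambda>k. k \<in> L2_class M f"])
  have h': "h' \<in> L2_class M h"
    unfolding h'_def using L2_class_self[OF assms(2)] by (rule someI[where P = "\<lambda>k. k \<in> L2_class M h"])
  have [measurable]: "f \<in> borel_measurable M" "h \<in> borel_measurable M"
      "f' \<in> borel_measurable M" "h' \<in> borel_measurable M"
    using assms f' h' by (auto simp: L2_fun_def L2_class_def)
  have "(AE x in M. f' x = f x)" "(AE x in M. h' x = h x)"
    using f' h' by (auto simp: L2_class_def)
  then have "AE x in M. (cmod (f' x - h' x))\<^sup>2 = (cmod (f x - h x))\<^sup>2"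
    by eventually_elim simp
  then have "(\<integral>x. (cmod (f' x - h' x))\<^sup>2 \<partial>M) = (\<integral>x. (cmod (f x - h x))\<^sup>2 \<partial>M)"
    by (intro integral_cong_AE) measurable
  then show ?thesis
    by (simp add: L2_dist_def f'_def h'_def)
qed

lemma sq_add_le:
  fixes a b t :: real
  assumes "t > 0"
  shows "(a + b)\<^sup>2 \<le> (1 + t) * a\<^sup>2 + (1 + 1 / t) * b\<^sup>2"
proof -
  have "0 \<le> (t * a - b)\<^sup>2 / t"
    using assms by simp
  also have "\<dots> = (1 + t) * a\<^sup>2 + (1 + 1 / t) * b\<^sup>2 - (a + b)\<^sup>2"
    using assms by (simp add: field_simps power2_eq_square)
  finally show ?thesis by simp
qed

lemma cmod_add_sq_le:
  assumes "t > 0"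
  shows "(cmod (u + v))\<^sup>2 \<le> (1 + t) * (cmod u)\<^sup>2 + (1 + 1 / t) * (cmod v)\<^sup>2"
proof -
  have "(cmod (u + v))\<^sup>2 \<le> (cmod u + cmod v)\<^sup>2"
    by (intro power_mono norm_triangle_ineq) simp
  also have "\<dots> \<le> (1 + t) * (cmod u)\<^sup>2 + (1 + 1 / t) * (cmod v)\<^sup>2"
    by (rule sq_add_le[OF assms])
  finally show ?thesis .
qed

lemma L2_fun_add:
  assumes "u \<in> L2_fun M" "v \<in> L2_fun M"
  shows "(\<lambda>x. u x + v x) \<in> L2_fun M"
proof -
  have [measurable]: "u \<in> borel_measurable M" "v \<in> borel_measurable M"
    using assms by (auto simp: L2_fun_def)
  have "integrable M (\<lambda>x. 2 * (cmod (u x))\<^sup>2 + 2 * (cmod (v x))\<^sup>2)"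
    using assms by (auto simp: L2_fun_def)
  then have "integrable M (\<lambda>x. (cmod (u x + v x))\<^sup>2)"
    by (rule Bochner_Integration.integrable_bound)
       (use cmod_add_sq_le[of 1] in \<open>auto intro!: AE_I2\<close>)
  then show ?thesis
    by (simp add: L2_fun_def)
qed

lemma L2_fun_diff:
  assumes "u \<in> L2_fun M" "v \<in> L2_fun M"
  shows "(\<lambda>x. u x - v x) \<in> L2_fun M"
  using L2_fun_add[OF assms(1), of "\<lambda>x. - v x"] assms(2) by (simp add: L2_fun_def)

lemma L2_minkowski:
  assumes "u \<in> L2_fun M" "v \<in> L2_fun M"
  shows "sqrt (\<integral>x. (cmod (u x + v x))\<^sup>2 \<partial>M)
       \<le> sqrt (\<integral>x. (cmod (u x))\<^sup>2 \<partial>M) + sqrt (\<integral>x. (cmod (v x))\<^sup>2 \<partial>M)"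
proof -
  have [measurable]: "u \<in> borel_measurable M" "v \<in> borel_measurable M"
    and iu: "integrable M (\<lambda>x. (cmod (u x))\<^sup>2)" and iv: "integrable M (\<lambda>x. (cmod (v x))\<^sup>2)"
    using assms by (auto simp: L2_fun_def)
  have iuv: "integrable M (\<lambda>x. (cmod (u x + v x))\<^sup>2)"
    using L2_fun_add[OF assms] by (simp add: L2_fun_def)
  define a where "a = sqrt (\<integral>x. (cmod (u x))\<^sup>2 \<partial>M)"
  define b where "b = sqrt (\<integral>x. (cmod (v x))\<^sup>2 \<partial>M)"
  have nonneg: "a \<ge> 0" "b \<ge> 0"
    by (auto simp: a_def b_def)
  have a2: "(\<integral>x. (cmod (u x))\<^sup>2 \<partial>M) = a\<^sup>2" and b2: "(\<integral>x. (cmod (v x))\<^sup>2 \<partial>M) = b\<^sup>2"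
    by (auto simp: a_def b_def)
  consider "a = 0" | "b = 0" | "a > 0" "b > 0"
    using nonneg by linarith
  then have "(\<integral>x. (cmod (u x + v x))\<^sup>2 \<partial>M) \<le> (a + b)\<^sup>2"
  proof cases
    case 1
    then have "AE x in M. (cmod (u x))\<^sup>2 = 0"
      using a2 integral_nonneg_eq_0_iff_AE[OF iu] by simp
    then have "(\<integral>x. (cmod (u x + v x))\<^sup>2 \<partial>M) = (\<integral>x. (cmod (v x))\<^sup>2 \<partial>M)"
      by (intro integral_cong_AE) auto
    then show ?thesis using 1 b2 by simp
  next
    case 2
    then have "AE x in M. (cmod (v x))\<^sup>2 = 0"
      using b2 integral_nonneg_eq_0_iff_AE[OF iv] by simp
    then have "(\<integral>x. (cmod (u x + v x))\<^sup>2 \<partial>M) = (\<integral>x. (cmod (u x))\<^sup>2 \<partial>M)"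
      by (intro integral_cong_AE) auto
    then show ?thesis using 2 a2 by simp
  next
    case 3
    define t where "t = b / a"
    have t: "t > 0" using 3 by (simp add: t_def)
    have "(\<integral>x. (cmod (u x + v x))\<^sup>2 \<partial>M)
        \<le> (\<integral>x. (1 + t) * (cmod (u x))\<^sup>2 + (1 + 1 / t) * (cmod (v x))\<^sup>2 \<partial>M)"
      by (intro integral_mono iuv Bochner_Integration.integrable_add integrable_mult_right iu iv
          cmod_add_sq_le t)
    also have "\<dots> = (1 + t) * a\<^sup>2 + (1 + 1 / t) * b\<^sup>2"
      using iu iv by (simp add: a2 b2)
    also have "\<dots> = (a + b)\<^sup>2"
      using 3 by (simp add: t_def field_simps power2_eq_square)
    finally show ?thesis .
  qed
  then have "sqrt (\<integral>x. (cmod (u x + v x))\<^sup>2 \<partial>M) \<le> a + b"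
    using nonneg by (intro real_le_lsqrt) auto
  then show ?thesis
    by (simp add: a_def b_def)
qed

lemma Metric_space_L2: "Metric_space (L2 M) (L2_dist M)"
proof
  show "0 \<le> L2_dist M A B" for A B
    by (simp add: L2_dist_def)
  show "L2_dist M A B = L2_dist M B A" for A B
    by (simp add: L2_dist_def norm_minus_commute)
  show "L2_dist M A B = 0 \<longleftrightarrow> A = B" if "A \<in> L2 M" "B \<in> L2 M" for A B
  proof -
    from that obtain f h where fh: "f \<in> L2_fun M" "h \<in> L2_fun M"
      and AB: "A = L2_class M f" "B = L2_class M h"
      by (auto simp: L2_def)
    have "L2_dist M A B = 0 \<longleftrightarrow> (\<integral>x. (cmod (f x - h x))\<^sup>2 \<partial>M) = 0"
      by (simp add: AB L2_dist_class fh)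
    also have "\<dots> \<longleftrightarrow> (AE x in M. (cmod (f x - h x))\<^sup>2 = 0)"
      using L2_fun_diff[OF fh] by (intro integral_nonneg_eq_0_iff_AE) (auto simp: L2_fun_def)
    also have "\<dots> \<longleftrightarrow> (AE x in M. f x = h x)"
      by simp
    also have "\<dots> \<longleftrightarrow> A = B"
    proof
      assume eq: "AE x in M. f x = h x"
      have "(AE x in M. k x = f x) \<longleftrightarrow> (AE x in M. k x = h x)" for k
        using eq by (auto elim: eventually_elim2)
      then show "A = B"
        by (simp add: AB L2_class_def)
    next
      assume "A = B"
      then have "f \<in> L2_class M h"
        using L2_class_self[OF fh(1)] AB by simp
      then show "AE x in M. f x = h x"
        by (simp add: L2_class_def)
    qed
    finally show ?thesis .
  qed
  show "L2_dist M A C \<le> L2_dist M A B + L2_dist M B C"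
    if "A \<in> L2 M" "B \<in> L2 M" "C \<in> L2 M" for A B C
  proof -
    from that obtain f h k where fhk: "f \<in> L2_fun M" "h \<in> L2_fun M" "k \<in> L2_fun M"
      and ABC: "A = L2_class M f" "B = L2_class M h" "C = L2_class M k"
      by (auto simp: L2_def)
    show ?thesis
      using L2_minkowski[OF L2_fun_diff[OF fhk(1,2)] L2_fun_diff[OF fhk(2,3)]]
      by (simp add: ABC L2_dist_class fhk)
  qed
qed

abbreviation L2_topology :: "'a measure \<Rightarrow> ('a \<Rightarrow> complex) set topology" where
  "L2_topology M \<equiv> Metric_space.mtopology (L2 M) (L2_dist M)"

definition precompact_in_L2 :: "'a measure \<Rightarrow> ('a \<Rightarrow> complex) set set \<Rightarrow> bool" where
  "precompact_in_L2 M S \<longleftrightarrow> S \<subseteq> L2 M \<and> compactin (L2_topology M) (L2_topology M closure_of S)"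

definition discrete_spectrum :: "('g \<Rightarrow> 'x::topological_space \<Rightarrow> 'x) \<Rightarrow> 'x measure \<Rightarrow> bool" where
  "discrete_spectrum act \<mu> \<longleftrightarrow>
     (\<forall>f :: 'x \<Rightarrow> complex. continuous_on UNIV f \<longrightarrow>
        precompact_in_L2 \<mu> (range (\<lambda>g. L2_class \<mu> (\<lambda>x. f (act g x)))))"

section \<open>Complexity\<close>

definition d_rho :: "('g \<Rightarrow> 'x \<Rightarrow> 'x) \<Rightarrow> 'g measure \<Rightarrow> 'x::metric_space \<Rightarrow> 'x \<Rightarrow> real" where
  "d_rho act \<rho> x y = (\<integral>g. dist (act g x) (act g y) \<partial>\<rho>)"

definition B_rho :: "('g \<Rightarrow> 'x \<Rightarrow> 'x) \<Rightarrow> 'g measure \<Rightarrow> 'x::metric_space \<Rightarrow> real \<Rightarrow> 'x set" where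
  "B_rho act \<rho> x \<epsilon> = {y. d_rho act \<rho> x y < \<epsilon>}"

text \<open>The minimum exists: finitely many balls cover \<open>X\<close>; see \<open>S_rho_well_defined\<close> below.\<close>

definition S_rho ::
  "('g \<Rightarrow> 'x \<Rightarrow> 'x) \<Rightarrow> 'x::metric_space measure \<Rightarrow> 'g measure \<Rightarrow> real \<Rightarrow> nat" where
  "S_rho act \<mu> \<rho> \<epsilon> =
     (LEAST K. \<exists>F. finite F \<and> card F = K \<and> measure \<mu> (\<Union>x\<in>F. B_rho act \<rho> x \<epsilon>) > 1 - \<epsilon>)"

definition rho_fin :: "'g::topological_space set \<Rightarrow> 'g measure" where
  "rho_fin E = measure_of UNIV (sets borel)
     (\<lambda>A. (\<Sum>g\<in>E. emeasure (return borel g) A) / of_nat (card E))"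

definition bounded_measure_max_mean_complexity ::
  "('g::topological_space \<Rightarrow> 'x \<Rightarrow> 'x) \<Rightarrow> 'x::metric_space measure \<Rightarrow> bool" where
  "bounded_measure_max_mean_complexity act \<mu> \<longleftrightarrow>
     (\<forall>\<epsilon>>0. \<exists>K>0. \<forall>\<rho>\<in>borel_prob_measures. S_rho act \<mu> \<rho> \<epsilon> < K)"

definition bounded_max_mean_complexity ::
  "('g::topological_space \<Rightarrow> 'x \<Rightarrow> 'x) \<Rightarrow> 'x::metric_space measure \<Rightarrow> bool" where
  "bounded_max_mean_complexity act \<mu> \<longleftrightarrow>
     (\<forall>\<epsilon>>0. \<exists>K>0. \<forall>E. finite E \<and> E \<noteq> {} \<longrightarrow> S_rho act \<mu> (rho_fin E) \<epsilon> < K)"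

lemma sets_rho_fin: "sets (rho_fin E) = sets borel"
  by (simp add: rho_fin_def sets.sigma_sets_eq[of borel, simplified])

lemma emeasure_rho_fin:
  assumes "A \<in> sets borel"
  shows "emeasure (rho_fin E) A = (\<Sum>g\<in>E. emeasure (return borel g) A) / of_nat (card E)"
  unfolding rho_fin_def
proof (rule emeasure_measure_of_sigma)
  show "sigma_algebra UNIV (sets (borel :: 'a measure))"
    using sets.sigma_algebra_axioms[of "borel :: 'a measure"] by simp
  show "positive (sets borel)
      (\<lambda>A. (\<Sum>g\<in>E. emeasure (return borel g) A) / of_nat (card E))"
    by (simp add: positive_def)
  show "countably_additive (sets borel)
      (\<lambda>A. (\<Sum>g\<in>E. emeasure (return borel g) A) / of_nat (card E))"
  proof (rule countably_additiveI)
    fix A :: "nat \<Rightarrow> 'a set"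
    assume A: "range A \<subseteq> sets borel" "disjoint_family A"
    have "(\<Sum>i. (\<Sum>g\<in>E. emeasure (return borel g) (A i)) / of_nat (card E))
        = (\<Sum>g\<in>E. \<Sum>i. emeasure (return borel g) (A i)) / of_nat (card E)"
      by (simp add: ennreal_suminf_divide suminf_sum)
    also have "(\<Sum>g\<in>E. \<Sum>i. emeasure (return borel g) (A i))
        = (\<Sum>g\<in>E. emeasure (return borel g) (\<Union>i. A i))"
      using A by (intro sum.cong refl suminf_emeasure) auto
    finally show "(\<Sum>i. (\<Sum>g\<in>E. emeasure (return borel g) (A i)) / of_nat (card E))
        = (\<Sum>g\<in>E. emeasure (return borel g) (\<Union>i. A i)) / of_nat (card E)" .
  qed
  show "A \<in> sets borel" by (rule assms)
qed

lemma rho_fin_in_borel_prob_measures: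
  assumes "finite E" "E \<noteq> {}"
  shows "rho_fin E \<in> borel_prob_measures"
proof -
  have "space (rho_fin E) = UNIV"
    using sets_eq_imp_space_eq[OF sets_rho_fin] by simp
  moreover have "of_nat (card E) / of_nat (card E) = (1 :: ennreal)"
    using assms by (intro ennreal_divide_self) (auto simp: of_nat_less_top)
  ultimately have "emeasure (rho_fin E) (space (rho_fin E)) = 1"
    by (simp add: emeasure_rho_fin)
  then show ?thesis
    by (auto simp: borel_prob_measures_def sets_rho_fin intro!: prob_spaceI)
qed

context locally_compact_group_action
begin

lemma continuous_on_act: "continuous_on UNIV (act g)"
proof -
  have "continuous_on UNIV ((\<lambda>(g, x). act g x) \<circ> Pair g)"
    by (intro continuous_on_compose continuous_intros continuous_on_subset[OF continuous_act]) auto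
  then show ?thesis by (simp add: o_def)
qed

lemma continuous_on_orbit: "continuous_on UNIV (\<lambda>g. act g x)"
proof -
  have "continuous_on UNIV ((\<lambda>(g, x). act g x) \<circ> (\<lambda>g. (g, x)))"
    by (intro continuous_on_compose continuous_intros continuous_on_subset[OF continuous_act]) auto
  then show ?thesis by (simp add: o_def)
qed

lemma continuous_on_d_rho:
  assumes "\<rho> \<in> borel_prob_measures"
  shows "continuous_on UNIV (d_rho act \<rho> x)"
proof -
  interpret prob_space \<rho>
    using assms by (simp add: borel_prob_measures_def)
  have sets: "sets \<rho> = sets borel"
    using assms by (simp add: borel_prob_measures_def)
  obtain B where B: "dist y z \<le> B" for y z :: 'x
    using compact_imp_bounded[OF compact_space] by (auto simp: bounded_two_points)
  have meas: "(\<lambda>g. dist (act g x) (act g y)) \<in> borel_measurable \<rho>" for y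
    unfolding measurable_cong_sets[OF sets refl]
    by (intro borel_measurable_continuous_onI continuous_intros continuous_on_orbit)
  have "(\<lambda>n. d_rho act \<rho> x (y n)) \<longlonglongrightarrow> d_rho act \<rho> x z" if "y \<longlonglongrightarrow> z" for y z
    unfolding d_rho_def
  proof (rule integral_dominated_convergence[where w = "\<lambda>_. B"])
    have "(\<lambda>n. act g (y n)) \<longlonglongrightarrow> act g z" for g
      by (rule continuous_on_tendsto_compose[OF continuous_on_act that]) auto
    then show "AE g in \<rho>. (\<lambda>n. dist (act g x) (act g (y n))) \<longlonglongrightarrow> dist (act g x) (act g z)"
      by (intro AE_I2 tendsto_dist tendsto_const)
  qed (use meas B in auto)
  then show ?thesis
    by (auto simp: continuous_on_sequentially o_def)
qed

lemma S_rho_well_defined: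
  assumes "\<mu> \<in> borel_prob_measures" "\<rho> \<in> borel_prob_measures" "\<epsilon> > 0"
  shows "\<exists>K F. finite F \<and> card F = K \<and> measure \<mu> (\<Union>x\<in>F. B_rho act \<rho> x \<epsilon>) > 1 - \<epsilon>"
proof -
  interpret prob_space \<mu>
    using assms by (simp add: borel_prob_measures_def)
  have "open (B_rho act \<rho> x \<epsilon>)" for x
    unfolding B_rho_def by (intro open_Collect_less continuous_on_d_rho assms continuous_intros)
  moreover have "x \<in> B_rho act \<rho> x \<epsilon>" for x
    using assms by (simp add: B_rho_def d_rho_def)
  then have "UNIV \<subseteq> (\<Union>x\<in>UNIV. B_rho act \<rho> x \<epsilon>)"
    by blast
  ultimately obtain F where F: "finite F" "UNIV \<subseteq> (\<Union>x\<in>F. B_rho act \<rho> x \<epsilon>)"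
    by (rule compactE_image[OF compact_space])
  have "space \<mu> = UNIV"
    using assms sets_eq_imp_space_eq[of \<mu> borel] by (simp add: borel_prob_measures_def)
  then have "measure \<mu> (\<Union>x\<in>F. B_rho act \<rho> x \<epsilon>) = 1"
    using F(2) prob_space by (simp add: top.extremum_unique)
  then show ?thesis
    using F(1) assms(3) by auto
qed

end

end

theory Submission
  imports Defs
begin

text \<open>The equivalence passes through a fourth condition that involves neither functions nor
  balls. Let \<open>D g h = \<integral> dist (g x) (h x) d\<mu>(x)\<close> (\<open>orbit_dist\<close>). The claim is that each of the
  three properties says that the group is totally bounded for the pseudometric \<open>D\<close>, that is, that
  the transformations \<open>x \<mapsto> g x\<close> form a totally bounded set of maps for the \<open>L\<^sup>1\<close> distance.

  Discrete spectrum is equivalent to total boundedness because \<open>L\<^sup>2(\<mu>)\<close> is complete and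
  because the metric of \<open>X\<close> and the continuous functions on \<open>X\<close> control each other: finitely many
  functions \<open>dist _ p\<close> determine the metric up to a small error
  (\<open>discrete_spectrum_imp_totally_bounded\<close>), and every continuous function is dominated by the
  metric up to a small error (\<open>totally_bounded_imp_discrete_spectrum\<close>).

  If the group is totally bounded, then for any \<open>\<rho>\<close> one may replace \<open>g\<close> by an element of a
  finite net. By Fubini and Markov this changes \<open>d\<^sub>\<rho>\<close> little on a set of large measure, and there the
  size of a cover depends on the net only (\<open>totally_bounded_imp_bounded_measure_complexity\<close>).
  Averages over finite sets are special cases of \<open>\<rho>\<close>.

  Conversely, if few balls suffice for the averages over all finite sets \<open>E\<close>, then at least half
  of the elements of \<open>E\<close> are close in \<open>L\<^sup>1\<close> to step maps with a bounded number of steps. Compactness of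
  \<open>X\<close> leaves boundedly many such maps up to a small error, so \<open>E\<close> cannot be both large and
  separated (\<open>bounded_complexity_imp_totally_bounded\<close>).\<close>

section \<open>Completeness of the space of square integrable functions\<close>

lemma (in prob_space) L1_norm_le_L2_norm:
  assumes "f \<in> L2_fun M"
  shows "integrable M f" "(\<integral>x. cmod (f x) \<partial>M) \<le> sqrt (\<integral>x. (cmod (f x))\<^sup>2 \<partial>M)"
proof -
  have [measurable]: "f \<in> borel_measurable M" and sq: "integrable M (\<lambda>x. (cmod (f x))\<^sup>2)"
    using assms by (auto simp: L2_fun_def)
  have int: "integrable M (\<lambda>x. cmod (f x))"
    by (rule square_integrable_imp_integrable[OF _ sq]) measurable
  then show "integrable M f"
    by (simp add: integrable_norm_iff)
  have "(\<integral>x. cmod (f x) \<partial>M)\<^sup>2 \<le> (\<integral>x. (cmod (f x))\<^sup>2 \<partial>M)"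
    using variance_eq[OF int sq] variance_positive[of "\<lambda>x. cmod (f x)"] by linarith
  then show "(\<integral>x. cmod (f x) \<partial>M) \<le> sqrt (\<integral>x. (cmod (f x))\<^sup>2 \<partial>M)"
    by (rule real_le_rsqrt)
qed

text \<open>The Riesz--Fischer theorem for a probability measure. A sequence Cauchy in \<open>L\<^sup>2\<close> is Cauchy
  in \<open>L\<^sup>1\<close>, so a subsequence converges almost everywhere, and Fatou's lemma identifies the
  pointwise limit as the limit in \<open>L\<^sup>2\<close>. Completeness turns precompactness into total
  boundedness.\<close>

lemma (in prob_space) L2_mcomplete: "Metric_space.mcomplete (L2 M) (L2_dist M)"
proof -
  interpret L2: Metric_space "L2 M" "L2_dist M"
    by (rule Metric_space_L2)
  show ?thesis
    unfolding L2.mcomplete_def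
  proof (intro allI impI)
    fix \<sigma> assume \<sigma>: "L2.MCauchy \<sigma>"
    then have "range \<sigma> \<subseteq> L2 M"
      by (simp add: L2.MCauchy_def)
    then have "\<forall>n. \<exists>f. f \<in> L2_fun M \<and> \<sigma> n = L2_class M f"
      unfolding L2_def by blast
    then obtain f where f: "f n \<in> L2_fun M" and \<sigma>_eq: "\<sigma> n = L2_class M (f n)" for n
      by metis
    have [measurable]: "f n \<in> borel_measurable M" for n
      using f by (simp add: L2_fun_def)
    have diff: "(\<lambda>x. f i x - f j x) \<in> L2_fun M" for i j
      by (intro L2_fun_diff f)
    have cauchy: "\<exists>N. \<forall>i\<ge>N. \<forall>j\<ge>N. sqrt (\<integral>x. (cmod (f i x - f j x))\<^sup>2 \<partial>M) < e" if "e > 0" for e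
      using \<sigma> that unfolding L2.MCauchy_def by (simp add: \<sigma>_eq L2_dist_class f)
    obtain r where r: "strict_mono r" and ae: "AE x in M. Cauchy (\<lambda>i. f (r i) x)"
    proof (rule cauchy_L1_AE_cauchy_subseq[of M f])
      show "integrable M (f n)" for n
        by (rule L1_norm_le_L2_norm[OF f])
      show "\<exists>N. \<forall>i\<ge>N. \<forall>j\<ge>N. (LINT x|M. cmod (f i x - f j x)) < e" if "e > 0" for e
        using cauchy[OF that] L1_norm_le_L2_norm(2)[OF diff] by (meson le_less_trans)
    qed
    define u where "u x = lim (\<lambda>i. f (r i) x)" for x
    have [measurable]: "u \<in> borel_measurable M"
      unfolding u_def by measurable
    have lim: "AE x in M. (\<lambda>i. f (r i) x) \<longlonglongrightarrow> u x"
      using ae by eventually_elim (simp add: u_def Cauchy_convergent_iff convergent_LIMSEQ_iff)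
    \<comment> \<open>By Fatou, the Cauchy estimate between two terms passes to the limit in one of them.\<close>
    have fatou: "(\<integral>\<^sup>+x. ennreal ((cmod (f m x - u x))\<^sup>2) \<partial>M) \<le> ennreal (e\<^sup>2)"
      if "e > 0" and N: "\<forall>i\<ge>N. \<forall>j\<ge>N. sqrt (\<integral>x. (cmod (f i x - f j x))\<^sup>2 \<partial>M) < e" and "m \<ge> N"
      for e N m
    proof -
      have "(\<integral>\<^sup>+x. ennreal ((cmod (f m x - u x))\<^sup>2) \<partial>M)
          = (\<integral>\<^sup>+x. liminf (\<lambda>k. ennreal ((cmod (f m x - f (r k) x))\<^sup>2)) \<partial>M)"
      proof (intro nn_integral_cong_AE)
        show "AE x in M. ennreal ((cmod (f m x - u x))\<^sup>2)
            = liminf (\<lambda>k. ennreal ((cmod (f m x - f (r k) x))\<^sup>2))"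
          using lim
        proof eventually_elim
          case (elim x)
          have "(\<lambda>k. ennreal ((cmod (f m x - f (r k) x))\<^sup>2)) \<longlonglongrightarrow> ennreal ((cmod (f m x - u x))\<^sup>2)"
            by (intro tendsto_ennrealI tendsto_power tendsto_norm tendsto_diff tendsto_const elim)
          then show ?case
            by (intro lim_imp_Liminf[symmetric]) auto
        qed
      qed
      also have "\<dots> \<le> liminf (\<lambda>k. \<integral>\<^sup>+x. ennreal ((cmod (f m x - f (r k) x))\<^sup>2) \<partial>M)"
        by (intro nn_integral_liminf) measurable
      also have "\<dots> \<le> ennreal (e\<^sup>2)"
      proof (intro Liminf_le)
        show "\<forall>\<^sub>F k in sequentially. (\<integral>\<^sup>+x. ennreal ((cmod (f m x - f (r k) x))\<^sup>2) \<partial>M) \<le> ennreal (e\<^sup>2)"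
          using eventually_ge_at_top[of N]
        proof eventually_elim
          case (elim k)
          then have "r k \<ge> N"
            using seq_suble[OF r, of k] by linarith
          then have "sqrt (\<integral>x. (cmod (f m x - f (r k) x))\<^sup>2 \<partial>M) < e"
            using N \<open>m \<ge> N\<close> by blast
          then have "(\<integral>x. (cmod (f m x - f (r k) x))\<^sup>2 \<partial>M) \<le> e\<^sup>2"
            using \<open>e > 0\<close> by (intro sqrt_le_D) simp
          moreover have "(\<integral>\<^sup>+x. ennreal ((cmod (f m x - f (r k) x))\<^sup>2) \<partial>M)
              = ennreal (\<integral>x. (cmod (f m x - f (r k) x))\<^sup>2 \<partial>M)"
            using diff by (intro nn_integral_eq_integral) (auto simp: L2_fun_def)
          ultimately show ?case
            by (simp add: ennreal_leI)
        qed
      qed auto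
      finally show ?thesis .
    qed
    have diff_u: "(\<lambda>x. f m x - u x) \<in> L2_fun M"
        "sqrt (\<integral>x. (cmod (f m x - u x))\<^sup>2 \<partial>M) \<le> e"
      if "e > 0" and "\<forall>i\<ge>N. \<forall>j\<ge>N. sqrt (\<integral>x. (cmod (f i x - f j x))\<^sup>2 \<partial>M) < e" and "m \<ge> N"
      for e N m
    proof -
      note le = fatou[OF that]
      then have "(\<integral>\<^sup>+x. ennreal ((cmod (f m x - u x))\<^sup>2) \<partial>M) < \<infinity>"
        by (simp add: le_less_trans)
      then have int: "integrable M (\<lambda>x. (cmod (f m x - u x))\<^sup>2)"
        by (intro integrableI_nonneg) auto
      then show "(\<lambda>x. f m x - u x) \<in> L2_fun M"
        by (simp add: L2_fun_def)
      have "(\<integral>x. (cmod (f m x - u x))\<^sup>2 \<partial>M) \<le> e\<^sup>2"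
        using le int by (simp add: nn_integral_eq_integral)
      then show "sqrt (\<integral>x. (cmod (f m x - u x))\<^sup>2 \<partial>M) \<le> e"
        using \<open>e > 0\<close> by (simp add: real_le_lsqrt)
    qed
    obtain N1 where "\<forall>i\<ge>N1. \<forall>j\<ge>N1. sqrt (\<integral>x. (cmod (f i x - f j x))\<^sup>2 \<partial>M) < 1"
      using cauchy[of 1] by auto
    then have "(\<lambda>x. f N1 x - (f N1 x - u x)) \<in> L2_fun M"
      by (intro L2_fun_diff f diff_u(1)[of 1 N1]) auto
    then have u: "u \<in> L2_fun M"
      by simp
    have "limitin L2.mtopology \<sigma> (L2_class M u) sequentially"
      unfolding L2.limitin_metric
    proof (intro conjI allI impI)
      show "L2_class M u \<in> L2 M"
        using u by (simp add: L2_def)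
      fix e :: real assume "e > 0"
      then obtain N where "\<forall>i\<ge>N. \<forall>j\<ge>N. sqrt (\<integral>x. (cmod (f i x - f j x))\<^sup>2 \<partial>M) < e / 2"
        using cauchy[of "e / 2"] by auto
      then have "L2_dist M (\<sigma> m) (L2_class M u) < e" if "m \<ge> N" for m
        using diff_u(2)[of "e / 2" N m] that \<open>e > 0\<close> by (simp add: \<sigma>_eq L2_dist_class f u)
      then show "\<forall>\<^sub>F m in sequentially. \<sigma> m \<in> L2 M \<and> L2_dist M (\<sigma> m) (L2_class M u) < e"
        using f by (auto simp: eventually_sequentially \<sigma>_eq L2_def)
    qed
    then show "\<exists>x. limitin L2.mtopology \<sigma> x sequentially" ..
  qed
qed

section \<open>Measurable finite approximation\<close>

text \<open>Giving priority to the member added last makes the choice measurable. Outside the cover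
  the value is arbitrary.\<close>

lemma simple_choice_from_finite_cover:
  assumes "finite I" "\<And>i. i \<in> I \<Longrightarrow> A i \<in> sets M"
  shows "\<exists>q. simple_function M q \<and> (\<forall>x\<in>(\<Union>i\<in>I. A i). q x \<in> I \<and> x \<in> A (q x))"
  using assms
proof (induction I rule: finite_induct)
  case empty
  show ?case by (intro exI[of _ "\<lambda>_. undefined"]) auto
next
  case (insert i I)
  then obtain q where q: "simple_function M q" "\<forall>x\<in>(\<Union>i\<in>I. A i). q x \<in> I \<and> x \<in> A (q x)"
    by auto
  show ?case
  proof (intro exI conjI)
    show "simple_function M (\<lambda>x. if x \<in> A i then i else q x)"
      using q(1) insert.prems[of i] by (intro simple_function_If_set) auto
  qed (use q(2) in auto)
qed

lemma measurable_compose_simple_function: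
  assumes q: "simple_function K q" and p: "p \<in> measurable M K"
    and F: "\<And>i. F i \<in> measurable M N"
  shows "(\<lambda>x. F (q (p x)) x) \<in> measurable M N"
proof (rule measurable_compose_countable'[where I = "q ` space K"])
  have "q \<in> measurable K (count_space (q ` space K))"
    using q by (subst measurable_count_space_eq2) (auto simp: simple_function_def)
  with p show "(\<lambda>x. q (p x)) \<in> measurable M (count_space (q ` space K))"
    by (rule measurable_compose)
  show "countable (q ` space K)"
    using q by (auto simp: simple_function_def intro: countable_finite)
qed (use F in auto)

lemma compact_simple_approximation:
  assumes "compact (UNIV :: 'x::metric_space set)" "e > 0"
  obtains q :: "'x::metric_space \<Rightarrow> 'x" where "simple_function borel q" "\<And>x. dist (q x) x < e"
proof -
  obtain k :: "'x set" where k: "finite k" "UNIV \<subseteq> (\<Union>x\<in>k. ball x e)"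
    using assms unfolding compact_eq_totally_bounded by blast
  obtain q where "simple_function borel q" "\<forall>x\<in>(\<Union>i\<in>k. ball i e). q x \<in> k \<and> x \<in> ball (q x) e"
    using simple_choice_from_finite_cover[OF k(1), of "\<lambda>x. ball x e" borel] by auto
  moreover have "x \<in> (\<Union>i\<in>k. ball i e)" for x
    using k(2) by blast
  ultimately show ?thesis
    using that[of q] by (simp only: mem_ball Ball_def)
qed

text \<open>A Caratheodory function of two variables is jointly measurable: it is the pointwise limit
  of its compositions with simple approximations of the identity in the continuous variable. For
  groups without a countable base the Borel sets of a product can exceed the product
  \<open>\<sigma>\<close>-algebra, so continuity of the action does not by itself justify Fubini's theorem; this
  lemma does.\<close>

lemma borel_measurable_Caratheodory:
  fixes F :: "'a \<Rightarrow> 'x::metric_space \<Rightarrow> real"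
  assumes "compact (UNIV :: 'x set)" and N: "sets N = sets borel"
    and meas: "\<And>x. (\<lambda>g. F g x) \<in> borel_measurable M"
    and cont: "\<And>g. continuous_on UNIV (F g)"
  shows "case_prod F \<in> borel_measurable (M \<Otimes>\<^sub>M N)"
proof -
  have "\<exists>q :: 'x \<Rightarrow> 'x. simple_function borel q \<and> (\<forall>x. dist (q x) x < 1 / real (Suc n))" for n
    using compact_simple_approximation[OF assms(1), of "1 / real (Suc n)"]
    by (metis of_nat_0_less_iff zero_less_Suc zero_less_divide_1_iff)
  then obtain q :: "nat \<Rightarrow> 'x \<Rightarrow> 'x" where q: "\<And>n. simple_function borel (q n)"
      "\<And>n x. dist (q n x) x < 1 / real (Suc n)"
    by metis
  show ?thesis
  proof (rule borel_measurable_LIMSEQ_metric)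
    fix n
    have "simple_function N (q n)"
      using q(1)[of n] sets_eq_imp_space_eq[OF N] by (simp add: simple_function_def N)
    then show "(\<lambda>p. F (fst p) (q n (snd p))) \<in> borel_measurable (M \<Otimes>\<^sub>M N)"
      by (rule measurable_compose_simple_function[where F = "\<lambda>x p. F (fst p) x", OF _ measurable_snd])
         (rule measurable_compose[OF measurable_fst meas])
  next
    fix p :: "'a \<times> 'x"
    have "(\<lambda>n. q n (snd p)) \<longlonglongrightarrow> snd p"
      unfolding tendsto_dist_iff[of "\<lambda>n. q n (snd p)"]
      by (rule tendsto_sandwich[OF _ _ tendsto_const LIMSEQ_inverse_real_of_nat])
         (use q(2) in \<open>auto simp: inverse_eq_divide intro!: always_eventually less_imp_le\<close>)
    then show "(\<lambda>n. F (fst p) (q n (snd p))) \<longlonglongrightarrow> case_prod F p"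
      by (auto simp: case_prod_beta intro: continuous_on_tendsto_compose[OF cont])
  qed
qed

section \<open>The mean distance of two transformations\<close>

locale measured_group_action = locally_compact_group_action act
  for act :: "'g::{topological_group_add, t2_space} \<Rightarrow> 'x::metric_space \<Rightarrow> 'x" +
  fixes \<mu> :: "'x measure"
  assumes mu: "\<mu> \<in> borel_prob_measures"
begin

sublocale mu: prob_space \<mu>
  using mu by (simp add: borel_prob_measures_def)

lemma sets_mu [measurable_cong]: "sets \<mu> = sets borel"
  using mu by (simp add: borel_prob_measures_def)

lemma space_mu [simp]: "space \<mu> = UNIV"
  using sets_eq_imp_space_eq[OF sets_mu] by simp

lemma measure_mu_UNIV [simp]: "measure \<mu> UNIV = 1"
  using mu.prob_space by simp

lemma borel_measurable_mu_continuous: "continuous_on UNIV f \<Longrightarrow> f \<in> borel_measurable \<mu>"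
  unfolding measurable_cong_sets[OF sets_mu refl] by (rule borel_measurable_continuous_onI)

lemma dist_le_diameter: "dist (x :: 'x) y \<le> diameter (UNIV :: 'x set)"
  by (rule diameter_bounded_bound[OF compact_imp_bounded[OF compact_space] UNIV_I UNIV_I])

lemma diameter_nonneg: "0 \<le> diameter (UNIV :: 'x set)"
  by (intro diameter_ge_0 compact_imp_bounded compact_space)

text \<open>The pullback to the group of the \<open>L\<^sup>1\<close> metric on measurable maps \<open>X \<rightarrow> X\<close>
  modulo equality almost everywhere.\<close>

definition orbit_dist :: "'g \<Rightarrow> 'g \<Rightarrow> real" where
  "orbit_dist g h = (\<integral>x. dist (act g x) (act h x) \<partial>\<mu>)"

definition orbit_map_totally_bounded :: bool where
  "orbit_map_totally_bounded \<longleftrightarrow>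
     (\<forall>\<eta>>0. \<exists>F. finite F \<and> (\<forall>g. \<exists>h\<in>F. orbit_dist g h < \<eta>))"

lemma orbit_dist_commute: "orbit_dist g h = orbit_dist h g"
  by (simp add: orbit_dist_def dist_commute)

lemma orbit_dist_self [simp]: "orbit_dist g g = 0"
  by (simp add: orbit_dist_def)

lemma integrable_dist_act: "integrable \<mu> (\<lambda>x. dist (act g x) (act h x))"
proof (rule mu.integrable_const_bound)
  show "(\<lambda>x. dist (act g x) (act h x)) \<in> borel_measurable \<mu>"
    by (intro borel_measurable_mu_continuous continuous_on_dist continuous_on_act)
qed (use dist_le_diameter in auto)

lemma continuous_in_L2_fun:
  fixes f :: "'x \<Rightarrow> complex"
  assumes "continuous_on UNIV f"
  shows "(\<lambda>x. f (act g x)) \<in> L2_fun \<mu>"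
proof -
  have "continuous_on UNIV (\<lambda>x. f (act g x))"
    using continuous_on_compose[OF continuous_on_act[of g], of f] assms
    by (auto simp: o_def intro: continuous_on_subset)
  then have [measurable]: "(\<lambda>x. f (act g x)) \<in> borel_measurable \<mu>"
    by (rule borel_measurable_mu_continuous)
  have "bounded (range f)"
    using compact_continuous_image[OF assms compact_space] by (rule compact_imp_bounded)
  then obtain B where B: "cmod (f x) \<le> B" for x
    by (auto simp: bounded_iff)
  have "integrable \<mu> (\<lambda>x. (cmod (f (act g x)))\<^sup>2)"
  proof (rule mu.integrable_const_bound)
    show "AE x in \<mu>. norm ((cmod (f (act g x)))\<^sup>2) \<le> B\<^sup>2"
      using B by (auto intro!: AE_I2 power_mono)
  qed measurable
  then show ?thesis
    by (simp add: L2_fun_def)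
qed

section \<open>Discrete spectrum\<close>

text \<open>Precompactness in the complete space \<open>L\<^sup>2(\<mu>)\<close> is total boundedness; a net
  inside an orbit is indexed by finitely many group elements, which removes the equivalence classes
  from the condition.\<close>

lemma discrete_spectrum_iff_finite_nets:
  "discrete_spectrum act \<mu> \<longleftrightarrow>
     (\<forall>f :: 'x \<Rightarrow> complex. continuous_on UNIV f \<longrightarrow>
        (\<forall>e>0. \<exists>F. finite F \<and>
           (\<forall>g. \<exists>h\<in>F. sqrt (\<integral>x. (cmod (f (act g x) - f (act h x)))\<^sup>2 \<partial>\<mu>) < e)))"
proof -
  interpret L2: Metric_space "L2 \<mu>" "L2_dist \<mu>"
    by (rule Metric_space_L2)
  have "precompact_in_L2 \<mu> (range (\<lambda>g. L2_class \<mu> (\<lambda>x. f (act g x)))) \<longleftrightarrow>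
      (\<forall>e>0. \<exists>F. finite F \<and>
         (\<forall>g. \<exists>h\<in>F. sqrt (\<integral>x. (cmod (f (act g x) - f (act h x)))\<^sup>2 \<partial>\<mu>) < e))"
    (is "_ \<longleftrightarrow> ?nets") if "continuous_on UNIV f" for f :: "'x \<Rightarrow> complex"
  proof -
    define c where "c g = L2_class \<mu> (\<lambda>x. f (act g x))" for g
    have cL2: "c g \<in> L2 \<mu>" for g
      unfolding c_def L2_def using continuous_in_L2_fun[OF that] by blast
    have dist_c: "L2_dist \<mu> (c h) (c g) = sqrt (\<integral>x. (cmod (f (act g x) - f (act h x)))\<^sup>2 \<partial>\<mu>)" for g h
      by (simp add: c_def L2_dist_class continuous_in_L2_fun[OF that] norm_minus_commute)
    have "precompact_in_L2 \<mu> (range c) \<longleftrightarrow> L2.mtotally_bounded (range c)"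
      by (simp add: precompact_in_L2_def L2.mtotally_bounded_eq_compact_closure_of[OF mu.L2_mcomplete])
    also have "\<dots> \<longleftrightarrow> (\<forall>e>0. \<exists>F. finite F \<and> (\<forall>g. \<exists>h\<in>F. L2_dist \<mu> (c h) (c g) < e))"
      unfolding L2.mtotally_bounded_def
    proof (intro iffI allI impI; elim allE impE; (assumption)?; elim exE conjE)
      fix e K assume "finite K" "K \<subseteq> range c" and K: "range c \<subseteq> (\<Union>x\<in>K. L2.mball x e)"
      then obtain F where F: "finite F" "K = c ` F"
        by (meson finite_subset_image)
      then have "\<exists>h\<in>F. L2_dist \<mu> (c h) (c g) < e" for g
        using K by (fastforce simp: subset_eq)
      with F show "\<exists>F. finite F \<and> (\<forall>g. \<exists>h\<in>F. L2_dist \<mu> (c h) (c g) < e)"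
        by blast
    next
      fix e F assume "finite F" "\<forall>g. \<exists>h\<in>F. L2_dist \<mu> (c h) (c g) < e"
      then show "\<exists>K. finite K \<and> K \<subseteq> range c \<and> range c \<subseteq> (\<Union>x\<in>K. L2.mball x e)"
        using cL2 by (intro exI[of _ "c ` F"]) auto
    qed
    finally show ?thesis
      unfolding dist_c by (simp add: c_def)
  qed
  then show ?thesis
    unfolding discrete_spectrum_def by blast
qed

lemma finite_net_of_colouring:
  assumes "finite (range \<tau>)" "\<And>g h. \<tau> g = \<tau> h \<Longrightarrow> orbit_dist g h < \<eta>"
  shows "\<exists>F. finite F \<and> (\<forall>g. \<exists>h\<in>F. orbit_dist g h < \<eta>)"
proof (intro exI conjI allI bexI)
  show "finite (inv \<tau> ` range \<tau>)"
    using assms(1) by simp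
  show "orbit_dist g (inv \<tau> (\<tau> g)) < \<eta>" for g
    by (rule assms(2)) (simp add: f_inv_into_f)
qed auto

text \<open>The functions \<open>dist _ p\<close>, for \<open>p\<close> in a finite \<open>\<delta>\<close>-net \<open>P\<close> of \<open>X\<close>, control the
  metric: \<open>dist x y \<le> 2\<delta> + (\<Sum>p\<in>P. \<bar>dist x p - dist y p\<bar>)\<close>, since some \<open>p\<close> is within
  \<open>\<delta>\<close> of \<open>x\<close>. Each of these finitely many functions has a totally bounded orbit, and recording
  for every \<open>p\<close> a nearby net element gives a finite colouring of the group whose classes are small
  in \<^const>\<open>orbit_dist\<close>.\<close>

lemma discrete_spectrum_imp_totally_bounded:
  assumes "discrete_spectrum act \<mu>"
  shows orbit_map_totally_bounded
  unfolding orbit_map_totally_bounded_def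
proof (intro allI impI)
  fix \<eta> :: real assume \<eta>: "\<eta> > 0"
  obtain q :: "'x \<Rightarrow> 'x" where q: "simple_function borel q" "\<And>x. dist (q x) x < \<eta> / 4"
    using compact_simple_approximation[OF compact_space, of "\<eta> / 4"] \<eta> by auto
  define P where "P = range q"
  have P: "finite P"
    using q(1) by (simp add: P_def simple_function_def)
  \<comment> \<open>Half of \<open>\<eta>\<close> is spent on the approximation by \<open>P\<close>; the other half must exceed an error of
    \<open>2 e\<close> for every point of \<open>P\<close>, one \<open>e\<close> for each of the two group elements compared.\<close>
  define e where "e = \<eta> / (8 * (card P + 1))"
  have e: "e > 0" "2 * e * card P < \<eta> / 2"
    using \<eta> by (auto simp: e_def field_simps add_pos_nonneg)
  define f where "f p x = complex_of_real (dist x p)" for p x :: 'x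
  have f: "continuous_on UNIV (f p)" for p
    unfolding f_def by (intro continuous_intros)
  have cmod_f: "cmod (f p x - f p y) = \<bar>dist x p - dist y p\<bar>" for p x y
    by (simp add: f_def flip: of_real_diff)
  have "\<forall>p. \<exists>F. finite F \<and>
      (\<forall>g. \<exists>h\<in>F. sqrt (\<integral>x. (cmod (f p (act g x) - f p (act h x)))\<^sup>2 \<partial>\<mu>) < e)"
    using assms f e(1) unfolding discrete_spectrum_iff_finite_nets by blast
  then obtain F where F: "finite (F p)"
      "\<exists>h\<in>F p. sqrt (\<integral>x. (cmod (f p (act g x) - f p (act h x)))\<^sup>2 \<partial>\<mu>) < e" for p g
    by metis
  then obtain c where c: "c p g \<in> F p"
      "sqrt (\<integral>x. (cmod (f p (act g x) - f p (act (c p g) x)))\<^sup>2 \<partial>\<mu>) < e" for p g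
    by metis
  have L2: "(\<lambda>x. f p (act g x) - f p (act h x)) \<in> L2_fun \<mu>" for p g h
    by (intro L2_fun_diff continuous_in_L2_fun f)
  have int: "integrable \<mu> (\<lambda>x. cmod (f p (act g x) - f p (act h x)))" for p g h
    by (intro integrable_norm mu.L1_norm_le_L2_norm L2)
  have near: "(\<integral>x. cmod (f p (act g x) - f p (act (c p g) x)) \<partial>\<mu>) < e" for p g
    using mu.L1_norm_le_L2_norm(2)[OF L2] c(2) by (rule le_less_trans)
  define \<tau> where "\<tau> g = restrict (\<lambda>p. c p g) P" for g
  show "\<exists>F. finite F \<and> (\<forall>g. \<exists>h\<in>F. orbit_dist g h < \<eta>)"
  proof (rule finite_net_of_colouring)
    have "range \<tau> \<subseteq> PiE P F"
      using c(1) by (auto simp: \<tau>_def)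
    then show "finite (range \<tau>)"
      by (rule finite_subset) (intro finite_PiE P F)
    fix g h assume \<tau>: "\<tau> g = \<tau> h"
    have col: "c p g = c p h" if "p \<in> P" for p
      using fun_cong[OF \<tau>, of p] that by (simp add: \<tau>_def)
    have each: "(\<integral>x. cmod (f p (act g x) - f p (act h x)) \<partial>\<mu>) \<le> 2 * e" if "p \<in> P" for p
    proof -
      have "(\<integral>x. cmod (f p (act g x) - f p (act h x)) \<partial>\<mu>)
          \<le> (\<integral>x. cmod (f p (act g x) - f p (act (c p g) x))
                + cmod (f p (act h x) - f p (act (c p h) x)) \<partial>\<mu>)"
        unfolding col[OF that]
        by (intro integral_mono Bochner_Integration.integrable_add int)
           (metis norm_minus_commute norm_triangle_sub diff_add_cancel norm_diff_triangle_ineq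
             dist_norm dist_triangle2)
      also have "\<dots> \<le> 2 * e"
        using near[of p g] near[of p h] by (simp add: int)
      finally show ?thesis .
    qed
    have pointwise: "dist x y \<le> \<eta> / 2 + (\<Sum>p\<in>P. cmod (f p x - f p y))" for x y
    proof -
      have "dist x y \<le> 2 * dist (q x) x + cmod (f (q x) x - f (q x) y)"
        using dist_triangle[of x y "q x"] unfolding cmod_f by (simp add: dist_commute)
      also have "\<dots> \<le> \<eta> / 2 + (\<Sum>p\<in>P. cmod (f p x - f p y))"
        using q(2)[of x] P by (intro add_mono member_le_sum) (auto simp: P_def)
      finally show ?thesis .
    qed
    have "orbit_dist g h \<le> (\<integral>x. \<eta> / 2 + (\<Sum>p\<in>P. cmod (f p (act g x) - f p (act h x))) \<partial>\<mu>)"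
      unfolding orbit_dist_def
      by (intro integral_mono integrable_dist_act pointwise Bochner_Integration.integrable_add
          Bochner_Integration.integrable_sum int) simp
    also have "\<dots> = \<eta> / 2 + (\<Sum>p\<in>P. \<integral>x. cmod (f p (act g x) - f p (act h x)) \<partial>\<mu>)"
      by (subst Bochner_Integration.integral_add)
         (auto simp: int Bochner_Integration.integral_sum)
    also have "\<dots> \<le> \<eta> / 2 + (\<Sum>p\<in>P. 2 * e)"
      by (intro add_left_mono sum_mono each)
    also have "\<dots> < \<eta>"
      using e(2) by (simp add: algebra_simps)
    finally show "orbit_dist g h < \<eta>" .
  qed
qed

text \<open>A continuous function on a compact space satisfies
  \<open>\<bar>f u - f v\<bar>\<^sup>2 \<le> \<delta> + C dist u v\<close> for every \<open>\<delta> > 0\<close> with a suitable \<open>C\<close>: uniform continuity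
  handles close points and boundedness the remaining ones. Integration bounds \<open>L\<^sup>2\<close> distances
  in the orbit of \<open>f\<close> by \<^const>\<open>orbit_dist\<close>.\<close>

lemma totally_bounded_imp_discrete_spectrum:
  assumes orbit_map_totally_bounded
  shows "discrete_spectrum act \<mu>"
  unfolding discrete_spectrum_iff_finite_nets
proof (intro allI impI)
  fix f :: "'x \<Rightarrow> complex" and e :: real
  assume f: "continuous_on UNIV f" and e: "e > 0"
  have "bounded (range f)"
    using compact_continuous_image[OF f compact_space] by (rule compact_imp_bounded)
  then obtain B where "B > 0" and B: "cmod (f x) \<le> B" for x
    by (auto simp: bounded_pos)
  have "uniformly_continuous_on UNIV f"
    using f compact_space by (rule compact_uniformly_continuous)
  then obtain r where r: "r > 0" "\<And>u v. dist u v < r \<Longrightarrow> cmod (f u - f v) < e / 2"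
    using e unfolding uniformly_continuous_on_def
    by (metis UNIV_I dist_commute dist_norm half_gt_zero)
  define C where "C = (2 * B)\<^sup>2 / r"
  have C: "C > 0"
    using r \<open>B > 0\<close> by (simp add: C_def)
  have pointwise: "(cmod (f u - f v))\<^sup>2 \<le> (e / 2)\<^sup>2 + C * dist u v" for u v
  proof (cases "dist u v < r")
    case True
    then have "(cmod (f u - f v))\<^sup>2 \<le> (e / 2)\<^sup>2"
      using r(2)[OF True] by (intro power_mono) auto
    then show ?thesis
      using C by (simp add: add_increasing2)
  next
    case False
    have "cmod (f u - f v) \<le> 2 * B"
      using norm_triangle_ineq4[of "f u" "f v"] B[of u] B[of v] by linarith
    then have "(cmod (f u - f v))\<^sup>2 \<le> (2 * B)\<^sup>2"
      by (intro power_mono) auto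
    also have "\<dots> = C * r"
      using r by (simp add: C_def)
    also have "\<dots> \<le> C * dist u v"
      using False C by simp
    finally show ?thesis
      by (simp add: add_increasing)
  qed
  obtain F where F: "finite F" "\<And>g. \<exists>h\<in>F. orbit_dist g h < e\<^sup>2 / (2 * C)"
    using assms C e unfolding orbit_map_totally_bounded_def
    by (metis mult_pos_pos zero_less_divide_iff zero_less_numeral zero_less_power)
  have "sqrt (\<integral>x. (cmod (f (act g x) - f (act h x)))\<^sup>2 \<partial>\<mu>) < e"
    if near: "orbit_dist g h < e\<^sup>2 / (2 * C)" for g h
  proof -
    have "(\<integral>x. (cmod (f (act g x) - f (act h x)))\<^sup>2 \<partial>\<mu>)
        \<le> (\<integral>x. (e / 2)\<^sup>2 + C * dist (act g x) (act h x) \<partial>\<mu>)"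
    proof (intro integral_mono pointwise)
      show "integrable \<mu> (\<lambda>x. (cmod (f (act g x) - f (act h x)))\<^sup>2)"
        using L2_fun_diff[OF continuous_in_L2_fun[OF f, of g] continuous_in_L2_fun[OF f, of h]]
        by (simp add: L2_fun_def)
    qed (simp add: integrable_dist_act)
    also have "\<dots> = (e / 2)\<^sup>2 + C * orbit_dist g h"
      by (simp add: integrable_dist_act orbit_dist_def mu.prob_space)
    also have "\<dots> < (e / 2)\<^sup>2 + C * (e\<^sup>2 / (2 * C))"
      using near C by (intro add_strict_left_mono mult_strict_left_mono)
    also have "\<dots> \<le> e\<^sup>2"
      using C by (simp add: power_divide)
    finally show ?thesis
      using e by (simp add: real_less_lsqrt)
  qed
  then show "\<exists>F. finite F \<and>
      (\<forall>g. \<exists>h\<in>F. sqrt (\<integral>x. (cmod (f (act g x) - f (act h x)))\<^sup>2 \<partial>\<mu>) < e)"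
    using F by meson
qed

end

section \<open>Complexity\<close>

lemma rho_fin_eq_uniform:
  assumes "finite E" "E \<noteq> {}"
  shows "rho_fin E = distr (measure_pmf (pmf_of_set E)) borel id"
proof (rule measure_eqI)
  fix A assume "A \<in> sets (rho_fin E)"
  then have A: "A \<in> sets borel"
    by (simp add: sets_rho_fin)
  have "(\<Sum>g\<in>E. emeasure (return borel g) A) = of_nat (card (E \<inter> A))"
    using assms(1) A by (simp add: indicator_def sum.If_cases Int_def)
  then show "emeasure (rho_fin E) A = emeasure (distr (measure_pmf (pmf_of_set E)) borel id) A"
    using assms A
    by (simp add: emeasure_rho_fin emeasure_distr emeasure_pmf_of_set divide_ennreal
        ennreal_of_nat_eq_real_of_nat card_gt_0_iff)
qed (simp add: sets_rho_fin)

lemma integral_rho_fin: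
  fixes f :: "'g::topological_space \<Rightarrow> real"
  assumes "finite E" "E \<noteq> {}" "f \<in> borel_measurable borel"
  shows "(\<integral>g. f g \<partial>rho_fin E) = (\<Sum>g\<in>E. f g) / card E"
  using assms by (simp add: rho_fin_eq_uniform integral_distr integral_pmf_of_set)

context locally_compact_group_action
begin

lemma d_rho_finite:
  assumes "finite E" "E \<noteq> {}"
  shows "d_rho act (rho_fin E) x y = (\<Sum>g\<in>E. dist (act g x) (act g y)) / card E"
  unfolding d_rho_def
  by (intro integral_rho_fin assms borel_measurable_continuous_onI continuous_on_dist
      continuous_on_orbit)

lemma open_B_rho: "\<rho> \<in> borel_prob_measures \<Longrightarrow> open (B_rho act \<rho> x \<epsilon>)"
  unfolding B_rho_def by (intro open_Collect_less continuous_on_d_rho continuous_intros)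

lemma S_rho_attained:
  assumes "\<mu> \<in> borel_prob_measures" "\<rho> \<in> borel_prob_measures" "\<epsilon> > 0"
  obtains F where "finite F" "card F = S_rho act \<mu> \<rho> \<epsilon>"
    "measure \<mu> (\<Union>x\<in>F. B_rho act \<rho> x \<epsilon>) > 1 - \<epsilon>"
  using LeastI_ex[OF S_rho_well_defined[OF assms]] unfolding S_rho_def by blast

end

lemma S_rho_le_card:
  assumes "finite F" "measure \<mu> (\<Union>x\<in>F. B_rho act \<rho> x \<epsilon>) > 1 - \<epsilon>"
  shows "S_rho act \<mu> \<rho> \<epsilon> \<le> card F"
  unfolding S_rho_def using assms by (intro Least_le) blast

context measured_group_action
begin

text \<open>Replace \<open>g\<close> by a nearby element \<open>j g\<close> of a finite net \<open>I\<close>. The averaged error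
  \<open>err x = \<integral> dist (g x) (j g x) d\<rho>(g)\<close> has small \<open>\<mu>\<close>-integral by Fubini, hence is small on a
  set \<open>A\<close> of large measure by Markov's inequality. On \<open>A\<close>, points that all elements of \<open>I\<close> keep
  close together are \<open>d\<^sub>\<rho>\<close>-close. The number of pieces on which the elements of \<open>I\<close> vary little
  depends on \<open>I\<close> and \<open>\<epsilon>\<close> but not on \<open>\<rho>\<close>.\<close>

lemma totally_bounded_imp_bounded_measure_complexity:
  assumes orbit_map_totally_bounded
  shows "bounded_measure_max_mean_complexity act \<mu>"
  unfolding bounded_measure_max_mean_complexity_def
proof (intro allI impI)
  fix \<epsilon> :: real assume \<epsilon>: "\<epsilon> > 0"
  \<comment> \<open>Markov's inequality at level \<open>\<epsilon> / 4\<close> then leaves an exceptional set of measure at most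
    \<open>4 \<eta> / \<epsilon> = \<epsilon> / 2\<close>.\<close>
  define \<eta> where "\<eta> = \<epsilon>\<^sup>2 / 8"
  have "\<eta> > 0"
    using \<epsilon> by (simp add: \<eta>_def)
  then obtain I where I: "finite I" "\<And>g. \<exists>h\<in>I. orbit_dist g h < \<eta>"
    using assms unfolding orbit_map_totally_bounded_def by blast
  define U where "U c = (\<Inter>h\<in>I. {x. dist (act h x) (act h c) < \<epsilon> / 4})" for c
  have "open (U c)" for c
    unfolding U_def
    by (intro open_INT I(1) ballI open_Collect_less continuous_on_dist continuous_on_act
        continuous_on_const)
  moreover have "UNIV \<subseteq> (\<Union>c\<in>UNIV. U c)"
    using \<epsilon> by (auto simp: U_def)
  ultimately obtain C where C: "finite C" "UNIV \<subseteq> (\<Union>c\<in>C. U c)"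
    by (rule compactE_image[OF compact_space])
  have "S_rho act \<mu> \<rho> \<epsilon> \<le> card C" if \<rho>: "\<rho> \<in> borel_prob_measures" for \<rho>
  proof -
    interpret \<rho>: prob_space \<rho>
      using \<rho> by (simp add: borel_prob_measures_def)
    have sets_\<rho> [measurable_cong]: "sets \<rho> = sets borel"
      using \<rho> by (simp add: borel_prob_measures_def)
    interpret pair_prob_space \<rho> \<mu> ..
    have dist_meas: "(\<lambda>g. dist (act g x) y) \<in> borel_measurable \<rho>" for x y
      unfolding measurable_cong_sets[OF sets_\<rho> refl]
      by (intro borel_measurable_continuous_onI continuous_on_dist continuous_on_orbit
          continuous_on_const)
    have "(\<lambda>g. orbit_dist g h) \<in> borel_measurable \<rho>" for h
      unfolding orbit_dist_def
      by (intro mu.borel_measurable_lebesgue_integral borel_measurable_Caratheodory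
          compact_space sets_mu dist_meas continuous_on_dist continuous_on_act)
    then have V_sets: "{g \<in> space \<rho>. orbit_dist g h < \<eta>} \<in> sets \<rho>" (is "?V h \<in> _") for h
      by measurable
    \<comment> \<open>Measurability of the choice of a nearby element of the net is what lets \<open>err\<close> below be
      integrated over both variables.\<close>
    obtain j where j: "simple_function \<rho> j"
      "\<forall>g\<in>(\<Union>h\<in>I. ?V h). j g \<in> I \<and> g \<in> ?V (j g)"
      using simple_choice_from_finite_cover[where M = \<rho> and A = "\<lambda>h. ?V h", OF I(1) V_sets]
      by (elim exE conjE)
    have space_\<rho>: "space \<rho> = UNIV"
      using sets_eq_imp_space_eq[OF sets_\<rho>] by simp
    have j_near: "j g \<in> I" "orbit_dist g (j g) < \<eta>" for g
      using j(2) I(2)[of g] by (auto simp: space_\<rho>)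
    define \<Phi> where "\<Phi> g x = dist (act g x) (act (j g) x)" for g x
    have \<Phi>_bound: "norm (\<Phi> g x) \<le> diameter (UNIV :: 'x set)" for g x
      by (simp add: \<Phi>_def dist_le_diameter)
    have \<Phi>_meas: "(\<lambda>g. \<Phi> g x) \<in> borel_measurable \<rho>" for x
      unfolding \<Phi>_def
      by (rule measurable_compose_simple_function[OF j(1) measurable_ident_sets[OF refl],
            where F = "\<lambda>h g. dist (act g x) (act h x)"]) (rule dist_meas)
    have "case_prod \<Phi> \<in> borel_measurable (\<rho> \<Otimes>\<^sub>M \<mu>)"
      by (intro borel_measurable_Caratheodory compact_space sets_mu \<Phi>_meas)
         (auto simp: \<Phi>_def intro!: continuous_on_dist continuous_on_act)
    then have int_\<Phi>: "integrable (\<rho> \<Otimes>\<^sub>M \<mu>) (case_prod \<Phi>)"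
      by (rule P.integrable_const_bound[rotated, where B = "diameter (UNIV :: 'x set)"])
         (use \<Phi>_bound in auto)
    have int_\<Phi>1: "integrable \<rho> (\<lambda>g. \<Phi> g x)" for x
      by (rule \<rho>.integrable_const_bound[OF _ \<Phi>_meas, where B = "diameter (UNIV :: 'x set)"])
         (use \<Phi>_bound in auto)
    define err where "err x = (\<integral>g. \<Phi> g x \<partial>\<rho>)" for x
    have err_nonneg: "err x \<ge> 0" for x
      unfolding err_def by (intro Bochner_Integration.integral_nonneg) (simp add: \<Phi>_def)
    have int_err: "integrable \<mu> err"
      unfolding err_def using integrable_snd[OF int_\<Phi>] by simp
    have "(\<integral>x. err x \<partial>\<mu>) = (\<integral>g. orbit_dist g (j g) \<partial>\<rho>)"
      unfolding err_def Fubini_integral[OF int_\<Phi>] by (simp add: \<Phi>_def[abs_def] orbit_dist_def)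
    also have "\<dots> \<le> \<eta>"
    proof (rule \<rho>.integral_le_const)
      show "integrable \<rho> (\<lambda>g. orbit_dist g (j g))"
        using integrable_fst'[OF int_\<Phi>] by (simp add: \<Phi>_def[abs_def] orbit_dist_def)
    qed (use j_near(2) in \<open>auto intro: less_imp_le\<close>)
    finally have err_le: "(\<integral>x. err x \<partial>\<mu>) \<le> \<eta>" .
    define A where "A = {x. err x < \<epsilon> / 4}"
    have "measure \<mu> {x \<in> space \<mu>. err x \<ge> \<epsilon> / 4} \<le> (\<integral>x. err x \<partial>\<mu>) / (\<epsilon> / 4)"
      using \<epsilon> int_err err_nonneg
      by (intro integral_Markov_inequality_measure[where A = "{}"]) auto
    also have "\<dots> \<le> \<eta> / (\<epsilon> / 4)"
      using err_le \<epsilon> by (intro divide_right_mono) auto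
    also have "\<dots> < \<epsilon>"
      using \<epsilon> by (simp add: \<eta>_def power2_eq_square)
    finally have compl: "measure \<mu> {x. err x \<ge> \<epsilon> / 4} < \<epsilon>"
      by simp
    have A_sets: "A \<in> sets \<mu>"
      using borel_measurable_integrable[OF int_err] unfolding A_def by measurable
    have "measure \<mu> A = 1 - measure \<mu> (UNIV - A)"
      using mu.prob_compl[OF A_sets] by simp
    moreover have "UNIV - A = {x. err x \<ge> \<epsilon> / 4}"
      by (auto simp: A_def)
    ultimately have A_large: "measure \<mu> A > 1 - \<epsilon>"
      using compl by simp
    \<comment> \<open>The estimate of \<open>d\<^sub>\<rho>\<close> needs both points in \<open>A\<close>, so the centre \<open>c\<close> of each piece that
      meets \<open>A\<close> is exchanged for a point \<open>s c\<close> of \<open>A\<close>.\<close>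
    define C' where "C' = {c \<in> C. \<exists>x\<in>A. x \<in> U c}"
    have "\<forall>c\<in>C'. \<exists>x. x \<in> A \<and> x \<in> U c"
      by (auto simp: C'_def)
    then obtain s where s: "\<And>c. c \<in> C' \<Longrightarrow> s c \<in> A \<and> s c \<in> U c"
      by metis
    have "A \<subseteq> (\<Union>y\<in>s ` C'. B_rho act \<rho> y \<epsilon>)"
    proof
      fix x assume x: "x \<in> A"
      obtain c where c: "c \<in> C" "x \<in> U c"
        using C(2) by blast
      with x have c': "c \<in> C'"
        by (auto simp: C'_def)
      define y where "y = s c"
      have y: "y \<in> A" "y \<in> U c"
        using s[OF c'] by (auto simp: y_def)
      have pointwise: "dist (act g y) (act g x) \<le> \<Phi> g y + \<epsilon> / 2 + \<Phi> g x" for g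
      proof -
        have "dist (act (j g) y) (act (j g) c) < \<epsilon> / 4" "dist (act (j g) x) (act (j g) c) < \<epsilon> / 4"
          using y(2) c(2) j_near(1)[of g] by (auto simp: U_def)
        then have "dist (act (j g) y) (act (j g) x) \<le> \<epsilon> / 2"
          using dist_triangle2[of "act (j g) y" "act (j g) x" "act (j g) c"] by linarith
        then show ?thesis
          using dist_triangle[of "act g y" "act g x" "act (j g) y"]
            dist_triangle[of "act (j g) y" "act g x" "act (j g) x"]
          unfolding \<Phi>_def by (simp add: dist_commute)
      qed
      have "d_rho act \<rho> y x \<le> (\<integral>g. \<Phi> g y + \<epsilon> / 2 + \<Phi> g x \<partial>\<rho>)"
        unfolding d_rho_def
      proof (intro integral_mono pointwise)
        show "integrable \<rho> (\<lambda>g. dist (act g y) (act g x))"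
        proof (rule \<rho>.integrable_const_bound)
          show "(\<lambda>g. dist (act g y) (act g x)) \<in> borel_measurable \<rho>"
            unfolding measurable_cong_sets[OF sets_\<rho> refl]
            by (intro borel_measurable_continuous_onI continuous_on_dist continuous_on_orbit)
        qed (use dist_le_diameter in auto)
      qed (simp add: int_\<Phi>1)
      also have "\<dots> = err y + \<epsilon> / 2 + err x"
        by (simp add: int_\<Phi>1 err_def \<rho>.prob_space)
      also have "\<dots> < \<epsilon>"
        using x y(1) by (simp add: A_def)
      finally show "x \<in> (\<Union>y\<in>s ` C'. B_rho act \<rho> y \<epsilon>)"
        using c' by (auto simp: B_rho_def y_def)
    qed
    moreover have "(\<Union>y\<in>s ` C'. B_rho act \<rho> y \<epsilon>) \<in> sets \<mu>"
      using open_B_rho[OF \<rho>] by (auto simp: sets_mu intro!: borel_open)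
    ultimately have "measure \<mu> (\<Union>y\<in>s ` C'. B_rho act \<rho> y \<epsilon>) > 1 - \<epsilon>"
      using mu.finite_measure_mono A_large by (meson less_le_trans)
    moreover have fin: "finite C'"
      using C(1) by (simp add: C'_def)
    ultimately have "S_rho act \<mu> \<rho> \<epsilon> \<le> card (s ` C')"
      by (intro S_rho_le_card) auto
    also have "\<dots> \<le> card C'"
      using fin by (rule card_image_le)
    also have "\<dots> \<le> card C"
      using C(1) by (intro card_mono) (auto simp: C'_def)
    finally show ?thesis .
  qed
  then show "\<exists>K>0. \<forall>\<rho>\<in>borel_prob_measures. S_rho act \<mu> \<rho> \<epsilon> < K"
    by (intro exI[of _ "Suc (card C)"]) (auto simp: less_Suc_eq_le)
qed

lemma exists_separated_set:
  assumes "\<And>F. finite F \<Longrightarrow> \<exists>g. \<forall>h\<in>F. \<eta> \<le> orbit_dist g h" "\<eta> > 0"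
  shows "\<exists>E. finite E \<and> card E = n \<and> (\<forall>g\<in>E. \<forall>h\<in>E. g \<noteq> h \<longrightarrow> \<eta> \<le> orbit_dist g h)"
proof (induction n)
  case 0
  show ?case by (intro exI[of _ "{}"]) simp
next
  case (Suc n)
  then obtain E where E: "finite E" "card E = n"
      "\<forall>g\<in>E. \<forall>h\<in>E. g \<noteq> h \<longrightarrow> \<eta> \<le> orbit_dist g h"
    by blast
  obtain g where g: "\<forall>h\<in>E. \<eta> \<le> orbit_dist g h"
    using assms(1)[OF E(1)] by blast
  have "g \<notin> E"
    using g assms(2) by force
  then show ?case
    using E g by (intro exI[of _ "insert g E"]) (auto simp: orbit_dist_commute[of _ g])
qed

text \<open>Suppose there are arbitrarily large finite sets \<open>E\<close> of pairwise \<open>\<eta>\<close>-separated group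
  elements. Bounded complexity covers most of \<open>X\<close> by fewer than \<open>K\<close> balls for the average over
  \<open>E\<close>, with \<open>K\<close> independent of \<open>E\<close>. Let \<open>\<kappa> x\<close> be the centre of a ball containing \<open>x\<close>. Averaging
  shows that at least half of the \<open>g \<in> E\<close> are \<open>L\<^sup>1\<close>-close to the step function
  \<open>x \<mapsto> g (\<kappa> x)\<close>. Such a step function is determined by fewer than \<open>K\<close> points of the compact space
  \<open>X\<close>, so up to a small error there are boundedly many of them; if \<open>E\<close> is large, two elements of
  \<open>E\<close> share one and are closer than \<open>\<eta>\<close>.\<close>

lemma bounded_complexity_imp_totally_bounded:
  assumes "bounded_max_mean_complexity act \<mu>"
  shows orbit_map_totally_bounded
proof (rule ccontr)
  assume "\<not> orbit_map_totally_bounded"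
  then obtain \<eta> where \<eta>: "\<eta> > 0" and no_net: "\<And>F. finite F \<Longrightarrow> \<exists>g. \<forall>h\<in>F. \<eta> \<le> orbit_dist g h"
    unfolding orbit_map_totally_bounded_def by (meson not_le)
  define L where "L = diameter (UNIV :: 'x set)"
  have L: "L \<ge> 0" "dist x y \<le> L" for x y :: 'x
    by (simp_all add: L_def diameter_nonneg dist_le_diameter)
  \<comment> \<open>The final estimate collects \<open>2\<epsilon>\<close> from each of the two step function approximations,
    \<open>2\<epsilon>\<close> from the pigeonhole cell, and \<open>L\<epsilon>\<close> from the uncovered set.\<close>
  define \<epsilon> where "\<epsilon> = \<eta> / (2 * (L + 6))"
  have \<epsilon>: "\<epsilon> > 0"
    using \<eta> L(1) by (auto simp: \<epsilon>_def)
  have "2 * (L + 6) \<noteq> 0"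
    using L(1) by simp
  then have "2 * (L + 6) * \<epsilon> = \<eta>"
    unfolding \<epsilon>_def by (metis nonzero_mult_div_cancel_left times_divide_eq_right)
  then have \<epsilon>_small: "(L + 6) * \<epsilon> < \<eta>"
    using \<eta> by argo
  obtain K where K: "\<And>E. finite E \<Longrightarrow> E \<noteq> {} \<Longrightarrow> S_rho act \<mu> (rho_fin E) \<epsilon> < K"
    using assms \<epsilon> unfolding bounded_max_mean_complexity_def by blast
  obtain q :: "'x \<Rightarrow> 'x" where q: "simple_function borel q" "\<And>x. dist (q x) x < \<epsilon>"
    using compact_simple_approximation[OF compact_space \<epsilon>] by auto
  define P where "P = range q"
  have P: "finite P" "card P \<ge> 1"
    using q(1) by (auto simp: P_def simple_function_def Suc_le_eq card_gt_0_iff)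
  \<comment> \<open>More than twice the number of maps from a set of at most \<open>K\<close> points to \<open>P\<close>: the pigeonhole
    principle is applied to half of \<open>E\<close>.\<close>
  define n where "n = 2 * card P ^ K + 1"
  obtain E where E: "finite E" "card E = n"
      "\<forall>g\<in>E. \<forall>h\<in>E. g \<noteq> h \<longrightarrow> \<eta> \<le> orbit_dist g h"
    using exists_separated_set[OF no_net \<eta>, of n] by blast
  have "E \<noteq> {}"
    using E(2) by (auto simp: n_def)
  note E_prob = rho_fin_in_borel_prob_measures[OF E(1) \<open>E \<noteq> {}\<close>]
  obtain F where F: "finite F" "card F = S_rho act \<mu> (rho_fin E) \<epsilon>"
    and U_large: "measure \<mu> (\<Union>x\<in>F. B_rho act (rho_fin E) x \<epsilon>) > 1 - \<epsilon>"
    using S_rho_attained[OF mu E_prob \<epsilon>] by blast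
  define U where "U = (\<Union>x\<in>F. B_rho act (rho_fin E) x \<epsilon>)"
  have B_sets: "B_rho act (rho_fin E) x \<epsilon> \<in> sets \<mu>" for x
    using open_B_rho[OF E_prob] by (simp add: sets_mu)
  have U_sets [measurable]: "U \<in> sets \<mu>"
    unfolding U_def using F(1) B_sets by auto
  obtain \<kappa> where \<kappa>: "simple_function \<mu> \<kappa>"
      "\<forall>x\<in>U. \<kappa> x \<in> F \<and> x \<in> B_rho act (rho_fin E) (\<kappa> x) \<epsilon>"
    using simple_choice_from_finite_cover[where M = \<mu>
        and A = "\<lambda>k. B_rho act (rho_fin E) k \<epsilon>", OF F(1) B_sets]
    unfolding U_def by (elim exE conjE)
  have \<kappa>_near: "\<kappa> x \<in> F" "(\<Sum>g\<in>E. dist (act g x) (act g (\<kappa> x))) < n * \<epsilon>" if "x \<in> U" for x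
  proof -
    show "\<kappa> x \<in> F"
      using \<kappa>(2) that by blast
    have "d_rho act (rho_fin E) (\<kappa> x) x < \<epsilon>"
      using \<kappa>(2) that by (simp add: B_rho_def)
    then show "(\<Sum>g\<in>E. dist (act g x) (act g (\<kappa> x))) < n * \<epsilon>"
      using d_rho_finite[OF E(1) \<open>E \<noteq> {}\<close>] E(2)
      by (simp add: n_def pos_divide_less_eq add_pos_nonneg dist_commute mult.commute)
  qed
  define \<phi> where "\<phi> g x = indicator U x * dist (act g x) (act g (\<kappa> x))" for g x
  have int_\<phi>: "integrable \<mu> (\<phi> g)" for g
  proof (rule mu.integrable_const_bound)
    have "(\<lambda>x. indicator U x * dist (act g x) (act g k)) \<in> borel_measurable \<mu>" for k
      by (intro borel_measurable_times borel_measurable_indicator U_sets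
          borel_measurable_mu_continuous continuous_on_dist continuous_on_act continuous_on_const)
    then have "(\<lambda>x. indicator U x * dist (act g x) (act g (\<kappa> x))) \<in> borel_measurable \<mu>"
      by (rule measurable_compose_simple_function[OF \<kappa>(1) measurable_ident_sets[OF refl],
            where F = "\<lambda>k x. indicator U x * dist (act g x) (act g k)"])
    then show "\<phi> g \<in> borel_measurable \<mu>"
      by (simp add: \<phi>_def[abs_def])
    show "AE x in \<mu>. norm (\<phi> g x) \<le> L"
      using L by (auto simp: \<phi>_def indicator_def)
  qed
  define a where "a g = (\<integral>x. \<phi> g x \<partial>\<mu>)" for g
  have a_nonneg: "a g \<ge> 0" for g
    unfolding a_def by (intro Bochner_Integration.integral_nonneg) (simp add: \<phi>_def)
  have "(\<Sum>g\<in>E. a g) = (\<integral>x. (\<Sum>g\<in>E. \<phi> g x) \<partial>\<mu>)"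
    unfolding a_def by (simp add: Bochner_Integration.integral_sum int_\<phi>)
  also have "\<dots> \<le> n * \<epsilon>"
  proof (rule mu.integral_le_const)
    have "(\<Sum>g\<in>E. \<phi> g x) \<le> n * \<epsilon>" for x
    proof (cases "x \<in> U")
      case True
      then show ?thesis
        using \<kappa>_near(2)[OF True] by (simp add: \<phi>_def less_imp_le)
    qed (use \<epsilon> in \<open>simp add: \<phi>_def\<close>)
    then show "AE x in \<mu>. (\<Sum>g\<in>E. \<phi> g x) \<le> n * \<epsilon>"
      by simp
  qed (simp add: int_\<phi>)
  finally have a_sum: "(\<Sum>g\<in>E. a g) \<le> n * \<epsilon>" .
  \<comment> \<open>The average of \<open>a\<close> over \<open>E\<close> is at most \<open>\<epsilon>\<close>, so at most half of \<open>E\<close> lies outside \<open>G\<close>.\<close>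
  define G where "G = {g \<in> E. a g \<le> 2 * \<epsilon>}"
  have G: "finite G" "G \<subseteq> E"
    using E(1) by (auto simp: G_def)
  have "card (E - G) * (2 * \<epsilon>) = (\<Sum>g\<in>E - G. 2 * \<epsilon>)"
    by simp
  also have "\<dots> \<le> (\<Sum>g\<in>E - G. a g)"
    by (intro sum_mono) (auto simp: G_def)
  also have "\<dots> \<le> (\<Sum>g\<in>E. a g)"
    using E(1) a_nonneg by (intro sum_mono2) auto
  finally have "card (E - G) * 2 * \<epsilon> \<le> n * \<epsilon>"
    using a_sum by simp
  then have "real (card (E - G) * 2) \<le> real n"
    using \<epsilon> by (rule mult_right_le_imp_le)
  then have "2 * card (E - G) \<le> n"
    by (simp only: of_nat_le_iff mult.commute)
  moreover have "card (E - G) = n - card G"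
    using G E(2) by (simp add: card_Diff_subset)
  ultimately have G_large: "card G > card P ^ K"
    by (simp add: n_def)
  define \<tau> where "\<tau> g = restrict (\<lambda>k. q (act g k)) F" for g
  have "card (\<tau> ` G) \<le> card (PiE F (\<lambda>_. P))"
    by (intro card_mono finite_PiE F P) (auto simp: \<tau>_def P_def)
  also have "\<dots> = card P ^ card F"
    using F(1) by (simp add: card_PiE)
  also have "\<dots> \<le> card P ^ K"
    using K[OF E(1) \<open>E \<noteq> {}\<close>] F(2) P(2) by (intro power_increasing) auto
  finally have "\<not> inj_on \<tau> G"
    using G_large by (intro pigeonhole) simp
  then obtain g h where gh: "g \<in> G" "h \<in> G" "g \<noteq> h" "\<tau> g = \<tau> h"
    by (auto simp: inj_on_def)
  have same_cell: "dist (act g k) (act h k) \<le> 2 * \<epsilon>" if "k \<in> F" for k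
  proof -
    have "q (act g k) = q (act h k)"
      using fun_cong[OF gh(4), of k] that by (simp add: \<tau>_def)
    then show ?thesis
      using q(2)[of "act g k"] q(2)[of "act h k"]
        dist_triangle3[of "act g k" "act h k" "q (act g k)"] by simp
  qed
  have pointwise: "dist (act g x) (act h x) \<le> \<phi> g x + \<phi> h x + 2 * \<epsilon> + L * indicator (UNIV - U) x" for x
  proof (cases "x \<in> U")
    case True
    have "dist (act g x) (act h x) \<le> dist (act g x) (act g (\<kappa> x))
        + (dist (act g (\<kappa> x)) (act h (\<kappa> x)) + dist (act h (\<kappa> x)) (act h x))"
      by (meson add_left_mono dist_triangle order_trans)
    then show ?thesis
      using True same_cell[OF \<kappa>_near(1)[OF True]] by (simp add: \<phi>_def dist_commute)
  next
    case False
    then show ?thesis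
      using L(2)[of "act g x" "act h x"] \<epsilon> by (simp add: \<phi>_def)
  qed
  have ind: "integrable \<mu> (indicator (UNIV - U) :: 'x \<Rightarrow> real)"
    using sets.compl_sets[OF U_sets] by (intro integrable_real_indicator) (auto simp: mu.emeasure_eq_measure)
  have compl: "measure \<mu> (UNIV - U) < \<epsilon>"
    using mu.prob_compl[OF U_sets] U_large by (simp add: U_def)
  have "orbit_dist g h \<le> (\<integral>x. \<phi> g x + \<phi> h x + 2 * \<epsilon> + L * indicator (UNIV - U) x \<partial>\<mu>)"
    unfolding orbit_dist_def
    by (intro integral_mono pointwise integrable_dist_act) (simp add: int_\<phi> ind)
  also have "\<dots> = a g + a h + 2 * \<epsilon> + L * measure \<mu> (UNIV - U)"
    by (simp add: int_\<phi> ind a_def)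
  also have "\<dots> \<le> 2 * \<epsilon> + 2 * \<epsilon> + 2 * \<epsilon> + L * \<epsilon>"
    using gh(1,2) compl L(1) by (intro add_mono mult_left_mono) (auto simp: G_def)
  also have "\<dots> < \<eta>"
    using \<epsilon>_small by (simp add: algebra_simps)
  finally show False
    using E(3) gh(1-3) G(2) by force
qed

end

lemma bounded_measure_complexity_imp_bounded_complexity:
  assumes "bounded_measure_max_mean_complexity act \<mu>"
  shows "bounded_max_mean_complexity act \<mu>"
  using assms rho_fin_in_borel_prob_measures
  unfolding bounded_measure_max_mean_complexity_def bounded_max_mean_complexity_def by meson

section \<open>The equivalence\<close>

theorem theorem1p1:
  fixes act :: "'g::{topological_group_add, t2_space} \<Rightarrow> 'x::metric_space \<Rightarrow> 'x"
    and \<mu> :: "'x measure"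
  assumes "locally_compact_group_action act"
    and "\<mu> \<in> borel_prob_measures"
  shows "(discrete_spectrum act \<mu> \<longleftrightarrow> bounded_measure_max_mean_complexity act \<mu>)
       \<and> (bounded_measure_max_mean_complexity act \<mu> \<longleftrightarrow> bounded_max_mean_complexity act \<mu>)"
proof -
  interpret measured_group_action act \<mu>
    using assms by (simp add: measured_group_action_def measured_group_action_axioms_def)
  show ?thesis
    using discrete_spectrum_imp_totally_bounded totally_bounded_imp_discrete_spectrum
      totally_bounded_imp_bounded_measure_complexity bounded_complexity_imp_totally_bounded
      bounded_measure_complexity_imp_bounded_complexity by blast
qed

end
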